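(* Let $P_0\succ0$ ($n\times n$), let $P_j=c_jc_j^\top+\nu I$ for $j\in\mathcal J$, and let $L_j\in\mathbb R^{m\times n}$, $\beta_j\ge0$, $\alpha_j\ge0$ ($j\in\mathcal J_0$) and $\Pi=[\pi_{j,k}]_{j,k\in\mathcal J_0}\in\mathcal M_+$ satisfy, for all $j\in\mathcal J_0$, $$\begin{bmatrix}\beta_jI&E^\top&0&0 \\ E&(\pi_{j,j}-\beta_j)P_j^{-1}+P_j^{-1}\Big(\sum_{k\in\mathcal J_0,k\ne j}\pi_{k,j}P_k\Big)P_j^{-1}&-P_j^{-1}&-L_j^\top \\ 0&-P_j^{-1}&0&0 \\ 0&-L_j&0&0\end{bmatrix}-\alpha_j\,\Gamma\,\Phi\,\Gamma^\top\succcurlyeq0,\qquad\Gamma:=\begin{bmatrix} 0&0 \\ I&\dot X \\ 0&-X \\ 0&-U\end{bmatrix}.$$ Consider the controller $$\sigma(x)=\min\{\operatorname{argmax}_{j\in\mathcal J_0}x^\top P_jx\},\qquad u(x)=K_{\sigma(x)}x,\qquad K_j:=L_jP_j .$$ Then any Carathéodory solution $x:\mathbb R_{\ge0}\to\mathbb R^n$ of the closed-loop system $\dot x=\bar Ax+\bar Bu(x)+E\psi$ with $x(0)\in\mathcal X_0$ satisfies $x(t)\in\mathcal X_0$ for all $t\ge0$. Further, if $\beta_j>0$ for all $j\in\mathcal J_0$ and $\psi(t)\to0$ as $t\to\infty$, then also $x(t)\to0$ as $t\to\infty$.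
   Context: The plant is $\dot x=\bar Ax+\bar Bu+E\psi$ with $x\in\mathbb R^n$, $u\in\mathbb R^m$, unknown true matrices $\bar A\in\mathbb R^{n\times n}$, $\bar B\in\mathbb R^{n\times m}$, known $E\in\mathbb R^{n\times q}$, and disturbance $\psi(t)\in\mathbb R^q$ with $\psi(t)^\top\psi(t)\le1$ for all $t$. Data matrices $X,\dot X\in\mathbb R^{n\times T}$, $U\in\mathbb R^{m\times T}$ (here $\dot X$ is just a name) satisfy $\dot X=\bar AX+\bar BU+\bar W$ for an unknown $\bar W\in\mathbb R^{n\times T}$ with $$\begin{bmatrix} I \\ \bar W^\top\end{bmatrix}^\top\Phi\begin{bmatrix} I \\ \bar W^\top\end{bmatrix}\succcurlyeq0,\qquad\Phi=\begin{bmatrix}\Phi_{1,1}&\Phi_{1,2} \\ \Phi_{1,2}^\top&\Phi_{2,2}\end{bmatrix}$$ a known symmetric matrix with $\Phi_{2,2}\prec0$ ($\Phi_{1,1}$ is $n\times n$, $\Phi_{2,2}$ is $T\times T$). State constraints: $\mathcal X:=\{x\mid|c_j^\top x|\le1\ \forall j\in\mathcal J\}$ with $\mathcal J=\{1,\dots,M\}$ and given $c_j\in\mathbb R^n$; $\mathcal J_0:=\mathcal J\cup\{0\}$; $\nu>0$ is a fixed constant. Put $v_{\max}(x):=\max_{j\in\mathcal J_0}x^\top P_jx$ and $\mathcal X_0:=\{x\in\mathbb R^n\mid v_{\max}(x)\le1\}\subset\mathcal X$. Here $\mathcal M_+$ is the set of real matrices $\Pi=[\pi_{j,k}]_{j,k\in\mathcal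 J_0}$ with $\pi_{j,k}>0$ for all $j\ne k$ and $\sum_{j\in\mathcal J_0}\pi_{j,k}=0$ for all $k$. The row blocks of $\Gamma$ have heights $q,n,n,m$ and its column blocks have widths $n,T$. A Carathéodory solution is an absolutely continuous function satisfying the closed-loop differential equation for almost all $t$. *)

theory Defs
  imports "HOL-Analysis.Analysis"
begin

definition psd :: "real^'n^'n \<Rightarrow> bool" where
  "psd A \<longleftrightarrow> transpose A = A \<and> (\<forall>x. 0 \<le> x \<bullet> (A *v x))"

definition pos_def :: "real^'n^'n \<Rightarrow> bool" where
  "pos_def A \<longleftrightarrow> transpose A = A \<and> (\<forall>x. x \<noteq> 0 \<longrightarrow> 0 < x \<bullet> (A *v x))"

definition outer :: "real^'n \<Rightarrow> real^'n \<Rightarrow> real^'n^'n" where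
  "outer a b = (\<chi> i j. a $ i * b $ j)"

text \<open>The rows (columns) of a block matrix are indexed by the sum of the index types of its
  row (column) blocks. Horizontal concatenation binds more tightly than vertical
  concatenation, so \<open>A <|> B </> C <|> D\<close> is the 2-by-2 block matrix with rows
  \<open>A, B\<close> and \<open>C, D\<close>.\<close>

definition hcat :: "real^'a^'r \<Rightarrow> real^'b^'r \<Rightarrow> real^('a + 'b)^'r" (infixr "<|>" 61) where
  "A <|> B = (\<chi> i j. case j of Inl k \<Rightarrow> A $ i $ k | Inr k \<Rightarrow> B $ i $ k)"

definition vcat :: "real^'c^'a \<Rightarrow> real^'c^'b \<Rightarrow> real^'c^('a + 'b)" (infixr "<'/>" 60) where
  "A </> B = (\<chi> i. case i of Inl k \<Rightarrow> A $ k | Inr k \<Rightarrow> B $ k)"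

definition Mplus :: "nat set \<Rightarrow> (nat \<Rightarrow> nat \<Rightarrow> real) \<Rightarrow> bool" where
  "Mplus J \<pi> \<longleftrightarrow>
     (\<forall>j\<in>J. \<forall>k\<in>J. j \<noteq> k \<longrightarrow> 0 < \<pi> j k) \<and> (\<forall>k\<in>J. (\<Sum>j\<in>J. \<pi> j k) = 0)"

definition Gam :: "real^'t^'n \<Rightarrow> real^'t^'n \<Rightarrow> real^'t^'m \<Rightarrow> real^('n + 't)^('q::finite + 'n + 'n + 'm)" where
  "Gam X Xd U =
     (0     <|> 0  </>
      mat 1 <|> Xd </>
      0     <|> -X </>
      0     <|> -U)"

definition lmi_matrix ::
  "nat set \<Rightarrow> real^'q^'n \<Rightarrow> (nat \<Rightarrow> real^'n^'n) \<Rightarrow> (nat \<Rightarrow> real^'n^'m) \<Rightarrow> (nat \<Rightarrow> real) \<Rightarrow>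
   (nat \<Rightarrow> nat \<Rightarrow> real) \<Rightarrow> nat \<Rightarrow> real^('q + 'n + 'n + 'm)^('q + 'n + 'n + 'm)" where
  "lmi_matrix J E P L \<beta> \<pi> j =
     (let R = matrix_inv (P j);
          S = (\<pi> j j - \<beta> j) *\<^sub>R R + R ** (\<Sum>k\<in>J - {j}. \<pi> k j *\<^sub>R P k) ** R
      in (\<beta> j *\<^sub>R mat 1 <|> transpose E <|> 0  <|> 0                </>
          E              <|> S           <|> -R <|> -transpose (L j) </>
          0              <|> -R          <|> 0  <|> 0                </>
          0              <|> -L j        <|> 0  <|> 0))"

definition vmax :: "nat set \<Rightarrow> (nat \<Rightarrow> real^'n^'n) \<Rightarrow> real^'n \<Rightarrow> real" where
  "vmax J P x = Max ((\<lambda>j. x \<bullet> (P j *v x)) ` J)"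

definition X0 :: "nat set \<Rightarrow> (nat \<Rightarrow> real^'n^'n) \<Rightarrow> (real^'n) set" where
  "X0 J P = {x. vmax J P x \<le> 1}"

definition switch :: "nat set \<Rightarrow> (nat \<Rightarrow> real^'n^'n) \<Rightarrow> real^'n \<Rightarrow> nat" where
  "switch J P x = Min {j. is_arg_max (\<lambda>j. x \<bullet> (P j *v x)) (\<lambda>j. j \<in> J) j}"

definition controller ::
  "nat set \<Rightarrow> (nat \<Rightarrow> real^'n^'n) \<Rightarrow> (nat \<Rightarrow> real^'n^'m) \<Rightarrow> real^'n \<Rightarrow> real^'m" where
  "controller J P L x = (L (switch J P x) ** P (switch J P x)) *v x"

text \<open>The divisions range over all finite families of nonoverlapping closed subintervals of
  \<open>S\<close>; degenerate members contribute nothing to either sum.\<close>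

definition abs_continuous_on :: "real set \<Rightarrow> (real \<Rightarrow> 'a::real_normed_vector) \<Rightarrow> bool" where
  "abs_continuous_on S f \<longleftrightarrow>
     (\<forall>\<epsilon>>0. \<exists>\<delta>>0. \<forall>D T. D division_of T \<and> T \<subseteq> S \<and> (\<Sum>K\<in>D. Sup K - Inf K) < \<delta> \<longrightarrow>
        (\<Sum>K\<in>D. norm (f (Sup K) - f (Inf K))) < \<epsilon>)"

text \<open>On the unbounded domain \<open>{0..}\<close> absolute continuity is required on compact
  subintervals, as is usual for solutions of differential equations.\<close>

definition caratheodory_solution ::
  "(real \<Rightarrow> 'a \<Rightarrow> 'a) \<Rightarrow> (real \<Rightarrow> 'a::real_normed_vector) \<Rightarrow> bool" where
  "caratheodory_solution f x \<longleftrightarrow>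
     (\<forall>b\<ge>0. abs_continuous_on {0..b} x) \<and>
     (AE t in lebesgue. 0 \<le> t \<longrightarrow> (x has_vector_derivative f t (x t)) (at t within {0..}))"

end

theory Submission
  imports Defs
begin

text \<open>Testing the matrix inequality for index \<open>j\<close> against \<open>(-\<psi>, P\<^sub>jx, A\<^sup>TP\<^sub>jx, B\<^sup>TP\<^sub>jx)\<close> turns the
  \<open>\<Gamma>\<close>-term into the noise bound, and what remains is the dissipation inequality
  \<open>d/dt (x\<^sup>TP\<^sub>jx) \<le> \<beta>\<^sub>j(|\<psi>|\<^sup>2 - x\<^sup>TP\<^sub>jx) + \<Sum>\<^sub>k \<pi>\<^sub>k\<^sub>j x\<^sup>TP\<^sub>kx\<close> along mode \<open>j\<close>, where the last sum is
  nonpositive if \<open>j\<close> is active. For an active \<open>j\<close> the backward difference quotients of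
  \<open>v\<^sub>m\<^sub>a\<^sub>x\<close> are bounded by those of \<open>x\<^sup>TP\<^sub>jx\<close>, so almost everywhere the upper left Dini derivative
  of the absolutely continuous function \<open>v\<^sub>m\<^sub>a\<^sub>x(x(t))\<close> is at most \<open>\<beta>\<^sub>j(|\<psi>|\<^sup>2 - v\<^sub>m\<^sub>a\<^sub>x)\<close>; no
  differentiability of \<open>v\<^sub>m\<^sub>a\<^sub>x\<close> along the solution is needed. Both claims follow by integrating this
  bound while \<open>v\<^sub>m\<^sub>a\<^sub>x\<close> exceeds a given level.\<close>

section \<open>Absolutely continuous functions\<close>

lemma abs_continuous_on_subset:
  assumes "abs_continuous_on S f" "T \<subseteq> S"
  shows "abs_continuous_on T f"
  unfolding abs_continuous_on_def
proof (intro allI impI)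
  fix e :: real assume "0 < e"
  then obtain d where "d > 0"
    "\<And>D R. D division_of R \<Longrightarrow> R \<subseteq> S \<Longrightarrow> (\<Sum>K\<in>D. Sup K - Inf K) < d \<Longrightarrow>
        (\<Sum>K\<in>D. norm (f (Sup K) - f (Inf K))) < e"
    using assms(1) unfolding abs_continuous_on_def by meson
  then show "\<exists>d>0. \<forall>D R. D division_of R \<and> R \<subseteq> T \<and> (\<Sum>K\<in>D. Sup K - Inf K) < d \<longrightarrow>
        (\<Sum>K\<in>D. norm (f (Sup K) - f (Inf K))) < e"
    using assms(2) by (intro exI[of _ d]) blast
qed

lemma abs_continuous_on_imp_continuous_on:
  fixes f :: "real \<Rightarrow> 'a::real_normed_vector"
  assumes "abs_continuous_on {a..b} f"
  shows "continuous_on {a..b} f"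
  unfolding continuous_on_iff
proof (intro ballI allI impI)
  fix t e :: real assume t: "t \<in> {a..b}" and "0 < e"
  then obtain d where d: "d > 0"
    "\<And>D T. D division_of T \<Longrightarrow> T \<subseteq> {a..b} \<Longrightarrow> (\<Sum>K\<in>D. Sup K - Inf K) < d \<Longrightarrow>
        (\<Sum>K\<in>D. norm (f (Sup K) - f (Inf K))) < e"
    using assms unfolding abs_continuous_on_def by meson
  have close: "norm (f v - f u) < e" if "u \<le> v" "u \<in> {a..b}" "v \<in> {a..b}" "v - u < d" for u v
    using d(2)[of "{cbox u v}" "cbox u v"] division_of_self[of u v] that by auto
  show "\<exists>d>0. \<forall>s\<in>{a..b}. dist s t < d \<longrightarrow> dist (f s) (f t) < e"
  proof (intro exI[of _ d] conjI ballI impI)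
    fix s assume "s \<in> {a..b}" "dist s t < d"
    then show "dist (f s) (f t) < e"
      using close[of s t] close[of t s] t
      by (cases "s \<le> t") (auto simp: dist_norm norm_minus_commute)
  qed (use d in auto)
qed

lemma abs_continuous_on_Lipschitz_compose:
  fixes f :: "real \<Rightarrow> 'a::real_normed_vector" and g :: "'a \<Rightarrow> 'b::real_normed_vector"
  assumes f: "abs_continuous_on S f"
    and g: "\<And>s t. s \<in> S \<Longrightarrow> t \<in> S \<Longrightarrow> norm (g (f s) - g (f t)) \<le> C * norm (f s - f t)"
  shows "abs_continuous_on S (\<lambda>t. g (f t))"
  unfolding abs_continuous_on_def
proof (intro allI impI)
  fix e :: real assume "0 < e"
  \<comment> \<open>\<open>C\<close> may be zero or negative, so the tolerance is divided by a
    positive bound \<open>B\<close> above it.\<close>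
  define B where "B = \<bar>C\<bar> + 1"
  have "B > 0" "C \<le> B" by (auto simp: B_def)
  then have "0 < e / B" using \<open>0 < e\<close> by simp
  then obtain d where d: "d > 0"
    "\<And>D T. D division_of T \<Longrightarrow> T \<subseteq> S \<Longrightarrow> (\<Sum>K\<in>D. Sup K - Inf K) < d \<Longrightarrow>
        (\<Sum>K\<in>D. norm (f (Sup K) - f (Inf K))) < e / B"
    using f unfolding abs_continuous_on_def by meson
  show "\<exists>d>0. \<forall>D T. D division_of T \<and> T \<subseteq> S \<and> (\<Sum>K\<in>D. Sup K - Inf K) < d \<longrightarrow>
        (\<Sum>K\<in>D. norm (g (f (Sup K)) - g (f (Inf K)))) < e"
  proof (intro exI[of _ d] conjI allI impI)
    fix D T assume D: "D division_of T \<and> T \<subseteq> S \<and> (\<Sum>K\<in>D. Sup K - Inf K) < d"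
    then have div: "D division_of T" by simp
    have ends: "Sup K \<in> S" "Inf K \<in> S" if "K \<in> D" for K
    proof -
      obtain u v where "K = cbox u v"
        using division_ofD(4)[OF div \<open>K \<in> D\<close>] by auto
      then show "Sup K \<in> S" "Inf K \<in> S"
        using D division_ofD(2,3)[OF div \<open>K \<in> D\<close>] by auto
    qed
    have "(\<Sum>K\<in>D. norm (g (f (Sup K)) - g (f (Inf K))))
        \<le> (\<Sum>K\<in>D. B * norm (f (Sup K) - f (Inf K)))"
    proof (rule sum_mono)
      fix K assume "K \<in> D"
      then have "norm (g (f (Sup K)) - g (f (Inf K))) \<le> C * norm (f (Sup K) - f (Inf K))"
        by (intro g ends)
      also have "\<dots> \<le> B * norm (f (Sup K) - f (Inf K))"
        using \<open>C \<le> B\<close> by (intro mult_right_mono) auto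
      finally show "norm (g (f (Sup K)) - g (f (Inf K))) \<le> B * norm (f (Sup K) - f (Inf K))" .
    qed
    also have "\<dots> = B * (\<Sum>K\<in>D. norm (f (Sup K) - f (Inf K)))"
      by (simp add: sum_distrib_left)
    also have "\<dots> < B * (e / B)"
      using d(2)[of D T] D \<open>B > 0\<close> by (intro mult_strict_left_mono) auto
    finally show "(\<Sum>K\<in>D. norm (g (f (Sup K)) - g (f (Inf K)))) < e"
      using \<open>B > 0\<close> by simp
  qed (use d in auto)
qed

text \<open>Members of a division overlap in null sets only, so their lengths add up to the measure
  of the union, which lies in \<open>G\<close>. This turns a small open cover of a null set into the
  small total length that absolute continuity asks for.\<close>

lemma sum_lengths_division_less:
  fixes D :: "real set set"
  assumes D: "D division_of T" and T: "T \<subseteq> G" and G: "G \<in> sets lebesgue"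
    and small: "emeasure lebesgue G < ennreal d"
  shows "(\<Sum>K\<in>D. Sup K - Inf K) < d"
proof -
  have "(\<Sum>K\<in>D. Sup K - Inf K) = (\<Sum>K\<in>D. measure lebesgue K)"
  proof (rule sum.cong)
    fix K assume "K \<in> D"
    then obtain u v where "K = cbox u v" "K \<noteq> {}"
      using division_ofD(3,4)[OF D] by blast
    then show "Sup K - Inf K = measure lebesgue K" by auto
  qed simp
  also have "\<dots> = measure lebesgue T" by (rule content_division[OF D])
  also have "\<dots> < d"
  proof -
    have fin: "G \<in> lmeasurable"
      using small G by (auto simp: fmeasurable_def less_top[symmetric] intro: order.strict_trans2)
    have "T \<in> sets lebesgue" using D by (meson lmeasurable_division fmeasurableD)
    then have "measure lebesgue T \<le> measure lebesgue G"
      using T fin by (intro measure_mono_fmeasurable)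
    moreover have "measure lebesgue G < d"
      using small fin by (metis emeasure_eq_measure2 ennreal_less_iff measure_nonneg)
    ultimately show ?thesis by simp
  qed
  finally show ?thesis .
qed

text \<open>Cover the exceptional null set by an open set \<open>G\<close> of small measure and move from \<open>b\<close> down
  to \<open>a\<close>: to the left of a nonexceptional point the increment is controlled by the Dini bound, to the
  left of an exceptional one it is collected into a division inside \<open>G\<close>, hence of small total length, to which absolute continuity applies. Charging
  \<open>\<bar>k\<bar>\<close> times the length to each such interval accounts for a negative \<open>k\<close>.\<close>

lemma abs_continuous_on_left_Dini_bound:
  fixes f :: "real \<Rightarrow> real"
  assumes ac: "abs_continuous_on {a..b} f" and "a \<le> b"
    and Dini: "AE t in lebesgue. a < t \<and> t \<le> b \<longrightarrow>
      (\<forall>e>0. eventually (\<lambda>s. f t - f s \<le> (k + e) * (t - s)) (at_left t))"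
  shows "f b - f a \<le> k * (b - a)"
proof (rule field_le_epsilon)
  fix e0 :: real assume "0 < e0"
  \<comment> \<open>The final error consists of \<open>e * (b - a)\<close> from the Dini bound,
    \<open>e\<close> from the slack \<open>h\<close> and less than \<open>2 * e\<close> from
    \<open>var D\<close>.\<close>
  define e where "e = e0 / (b - a + 3)"
  have "0 < e" using \<open>0 < e0\<close> \<open>a \<le> b\<close> by (simp add: e_def)
  have cont: "continuous_on {a..b} f"
    using ac by (rule abs_continuous_on_imp_continuous_on)
  obtain d0 where d0: "d0 > 0"
    "\<And>D T. D division_of T \<Longrightarrow> T \<subseteq> {a..b} \<Longrightarrow> (\<Sum>K\<in>D. Sup K - Inf K) < d0 \<Longrightarrow>
        (\<Sum>K\<in>D. norm (f (Sup K) - f (Inf K))) < e"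
    using ac \<open>0 < e\<close> unfolding abs_continuous_on_def by meson
  \<comment> \<open>The first bound lets absolute continuity apply, the second keeps the total
    charge \<open>\<bar>k\<bar>\<close> times length below \<open>e\<close>.\<close>
  define d where "d = min d0 (e / (\<bar>k\<bar> + 1))"
  have "0 < d" using d0(1) \<open>0 < e\<close> by (simp add: d_def)
  obtain N where N: "N \<in> null_sets lebesgue"
    "\<And>t. t \<notin> N \<Longrightarrow> a < t \<Longrightarrow> t \<le> b \<Longrightarrow>
      eventually (\<lambda>s. f t - f s \<le> (k + e) * (t - s)) (at_left t)"
    using Dini \<open>0 < e\<close> by (fastforce elim!: AE_E3)
  obtain G where G: "open G" "N \<subseteq> G" "emeasure lebesgue G < ennreal d"
  proof -
    obtain G where G: "open G" "N \<subseteq> G" "G - N \<in> lmeasurable" "emeasure lebesgue (G - N) < ennreal d"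
      using sets_lebesgue_outer_open[of N d] N(1) \<open>0 < d\<close> by blast
    have "emeasure lebesgue (G - N) = emeasure lebesgue G"
      using N(1) G(1) by (intro emeasure_Diff_null_set) auto
    then show ?thesis using that G by simp
  qed
  define var where "var D = (\<Sum>K\<in>D. norm (f (Sup K) - f (Inf K)) + \<bar>k\<bar> * (Sup K - Inf K))"
    for D :: "real set set"
  \<comment> \<open>The slack \<open>h\<close> lets goodness pass to the infimum \<open>m\<close>:
    continuity of \<open>f\<close> moves a good point just above \<open>m\<close> down to
    \<open>m\<close> at an arbitrarily small cost.\<close>
  define good where "good t \<longleftrightarrow> (\<forall>h>0. \<exists>D T. D division_of T \<and> T \<subseteq> G \<inter> {t..b} \<and>
      f b - f t \<le> (k + e) * (b - t) + h + var D)" for t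
  define m where "m = Inf {t \<in> {a..b}. good t}"
  have "good b"
    unfolding good_def var_def by (intro allI impI exI[of _ "{}"]) auto
  then have ne: "{t \<in> {a..b}. good t} \<noteq> {}" using \<open>a \<le> b\<close> by auto
  have bdd: "bdd_below {t \<in> {a..b}. good t}" by (rule bdd_belowI[of _ a]) auto
  have m: "m \<in> {a..b}"
    using \<open>good b\<close> \<open>a \<le> b\<close> ne bdd unfolding m_def
    by (auto intro!: cInf_greatest cInf_lower)
  have "good m"
    unfolding good_def
  proof (intro allI impI)
    fix h :: real assume "0 < h"
    have "continuous_on {a..b} (\<lambda>t. f t - (k + e) * t)" using cont by (intro continuous_intros)
    then obtain r where r: "r > 0"
      "\<And>t. t \<in> {a..b} \<Longrightarrow> dist t m < r \<Longrightarrow> dist (f t - (k + e) * t) (f m - (k + e) * m) < h / 2"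
      using m \<open>0 < h\<close> unfolding continuous_on_iff by (metis half_gt_zero)
    obtain t where t: "t \<in> {a..b}" "good t" "t < m + r"
      using cInf_lessD[OF ne, of "m + r"] r(1) unfolding m_def by auto
    have "m \<le> t" unfolding m_def using t by (intro cInf_lower bdd) auto
    obtain D T where D: "D division_of T" "T \<subseteq> G \<inter> {t..b}"
      "f b - f t \<le> (k + e) * (b - t) + h / 2 + var D"
      using t(2) \<open>0 < h\<close> unfolding good_def by (metis half_gt_zero)
    have "\<bar>(f t - (k + e) * t) - (f m - (k + e) * m)\<bar> < h / 2"
      using r(2)[of t] t \<open>m \<le> t\<close> by (auto simp: dist_real_def)
    then have "f b - f m \<le> (k + e) * (b - m) + h + var D"
      using D(3) unfolding right_diff_distrib by linarith
    then show "\<exists>D T. D division_of T \<and> T \<subseteq> G \<inter> {m..b} \<and>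
      f b - f m \<le> (k + e) * (b - m) + h + var D"
      using D \<open>m \<le> t\<close> by (intro exI[of _ D] exI[of _ T]) auto
  qed
  have "m = a"
  proof (rule ccontr)
    assume "m \<noteq> a"
    then have "a < m" using m by auto
    \<comment> \<open>Goodness extends from \<open>m\<close> a little to the left, against the
      choice of \<open>m\<close> as the infimum.\<close>
    have "eventually (\<lambda>s. s \<in> {a<..<m} \<and> good s) (at_left m)"
    proof (cases "m \<in> N")
      case True
      then obtain r where r: "r > 0" "ball m r \<subseteq> G"
        using G by (meson openE subsetD)
      have "good s" if "s \<in> {max a (m - r)<..<m}" for s
        unfolding good_def
      proof (intro allI impI)
        fix h :: real assume "0 < h"
        then obtain D T where D: "D division_of T" "T \<subseteq> G \<inter> {m..b}"
          "f b - f m \<le> (k + e) * (b - m) + h / 2 + var D"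
          using \<open>good m\<close> unfolding good_def by (metis half_gt_zero)
        show "\<exists>D T. D division_of T \<and> T \<subseteq> G \<inter> {s..b} \<and>
          f b - f s \<le> (k + e) * (b - s) + h + var D"
        proof (intro exI conjI)
          have "interior T \<subseteq> interior {m..b}"
            using D(2) by (intro interior_mono) auto
          then have "interior T \<inter> interior (cbox s m) = {}" by auto
          then show "(D \<union> {cbox s m}) division_of (T \<union> cbox s m)"
            using that by (intro division_disjoint_union D division_of_self) auto
          have "cbox s m \<subseteq> ball m r" using that by (auto simp: dist_real_def)
          then show "T \<union> cbox s m \<subseteq> G \<inter> {s..b}"
            using D(2) r(2) that m by auto
          have "cbox s m \<notin> D"
          proof
            assume "cbox s m \<in> D"
            then have "cbox s m \<subseteq> {m..b}" using D(2) division_ofD(2)[OF D(1)] by blast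
            then show False using that by auto
          qed
          moreover have "finite D" using D(1) by (rule division_of_finite)
          ultimately have "var (D \<union> {cbox s m}) = var D + \<bar>f m - f s\<bar> + \<bar>k\<bar> * (m - s)"
            using that unfolding var_def by simp
          \<comment> \<open>Moving the base point from \<open>m\<close> to \<open>s\<close> adds
            \<open>(k + e) * (m - s)\<close> to the linear term. If this is negative, the charge in
            \<open>var\<close> makes up for it.\<close>
          moreover have "- (k + e) * (m - s) \<le> \<bar>k\<bar> * (m - s)"
            using that \<open>0 < e\<close> by (intro mult_right_mono) auto
          ultimately show "f b - f s \<le> (k + e) * (b - s) + h + var (D \<union> {cbox s m})"
            using D(3) \<open>0 < h\<close> by (auto simp: algebra_simps)
        qed
      qed
      moreover have "eventually (\<lambda>s. s \<in> {max a (m - r)<..<m}) (at_left m)"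
        using \<open>a < m\<close> r(1) by (intro eventually_at_left_real) auto
      ultimately show ?thesis by (auto elim!: eventually_mono)
    next
      case False
      have "eventually (\<lambda>s. f m - f s \<le> (k + e) * (m - s)) (at_left m)"
        using N(2)[OF False] \<open>a < m\<close> m by simp
      moreover have "eventually (\<lambda>s. s \<in> {a<..<m}) (at_left m)"
        using \<open>a < m\<close> by (rule eventually_at_left_real)
      ultimately show ?thesis
      proof eventually_elim
        case (elim s)
        have "good s"
          unfolding good_def
        proof (intro allI impI)
          fix h :: real assume "0 < h"
          then obtain D T where D: "D division_of T" "T \<subseteq> G \<inter> {m..b}"
            "f b - f m \<le> (k + e) * (b - m) + h + var D"
            using \<open>good m\<close> unfolding good_def by metis
          moreover have "f b - f s \<le> (k + e) * (b - s) + h + var D"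
            using D(3) elim(1) unfolding right_diff_distrib by linarith
          ultimately show "\<exists>D T. D division_of T \<and> T \<subseteq> G \<inter> {s..b} \<and>
            f b - f s \<le> (k + e) * (b - s) + h + var D"
            using elim(2) by (intro exI[of _ D] exI[of _ T]) auto
        qed
        then show ?case using elim by simp
      qed
    qed
    then obtain s where "s \<in> {a<..<m}" "good s"
      using eventually_happens' trivial_limit_at_left_real by (metis (mono_tags, lifting))
    moreover from this have "s \<in> {t \<in> {a..b}. good t}" using m by auto
    then have "m \<le> s" unfolding m_def by (rule cInf_lower[OF _ bdd])
    ultimately show False by simp
  qed
  then obtain D T where D: "D division_of T" "T \<subseteq> G \<inter> {a..b}"
    "f b - f a \<le> (k + e) * (b - a) + e + var D"
    using \<open>good m\<close> \<open>0 < e\<close> unfolding good_def by metis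
  have len: "(\<Sum>K\<in>D. Sup K - Inf K) < d"
    using D G by (intro sum_lengths_division_less[of D T G]) auto
  then have "(\<Sum>K\<in>D. norm (f (Sup K) - f (Inf K))) < e"
    using D by (intro d0(2)[of D T]) (auto simp: d_def)
  moreover have "\<bar>k\<bar> * (\<Sum>K\<in>D. Sup K - Inf K) \<le> e"
  proof -
    have "\<bar>k\<bar> * (\<Sum>K\<in>D. Sup K - Inf K) \<le> \<bar>k\<bar> * (e / (\<bar>k\<bar> + 1))"
      using len by (intro mult_left_mono) (auto simp: d_def)
    also have "\<dots> \<le> e" using \<open>0 < e\<close> by (simp add: field_simps)
    finally show ?thesis .
  qed
  ultimately have "var D < 2 * e"
    unfolding var_def by (simp add: sum.distrib sum_distrib_left)
  then have "f b - f a \<le> k * (b - a) + e * (b - a + 3)"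
    using D(3) by (simp add: algebra_simps)
  then show "f b - f a \<le> k * (b - a) + e0"
    using \<open>a \<le> b\<close> by (simp add: e_def)
qed

text \<open>After the last time \<open>m\<close> at which \<open>f\<close> is at most
  \<open>c\<close>, the Dini bound with \<open>k = 0\<close> holds almost everywhere up to
  \<open>b\<close>, so \<open>f\<close> cannot have grown since \<open>m\<close>.\<close>

lemma abs_continuous_on_sublevel_invariant:
  fixes f :: "real \<Rightarrow> real"
  assumes ac: "abs_continuous_on {a..b} f" and "a \<le> b" and init: "f a \<le> c"
    and Dini: "AE t in lebesgue. a < t \<and> t \<le> b \<and> c < f t \<longrightarrow>
      (\<forall>e>0. eventually (\<lambda>s. f t - f s \<le> e * (t - s)) (at_left t))"
  shows "f b \<le> c"
proof (rule ccontr)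
  assume "\<not> f b \<le> c"
  define S where "S = {t \<in> {a..b}. f t \<le> c}"
  define m where "m = Sup S"
  have cont: "continuous_on {a..b} f"
    using ac by (rule abs_continuous_on_imp_continuous_on)
  have "a \<in> S" using \<open>a \<le> b\<close> init by (simp add: S_def)
  have "closed S"
    unfolding S_def using continuous_closed_preimage[OF cont closed_real_atLeastAtMost closed_atMost[of c]]
    by (simp add: vimage_def Int_def)
  moreover have "bdd_above S" by (rule bdd_aboveI[of _ b]) (auto simp: S_def)
  ultimately have "m \<in> S"
    unfolding m_def using \<open>a \<in> S\<close> by (intro closed_contains_Sup) auto
  have above: "c < f t" if "m < t" "t \<le> b" for t
  proof (rule ccontr)
    assume "\<not> c < f t"
    then have "t \<in> S" using that \<open>m \<in> S\<close> by (auto simp: S_def)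
    then show False using that cSup_upper[OF _ \<open>bdd_above S\<close>] unfolding m_def by fastforce
  qed
  have "f b - f m \<le> 0 * (b - m)"
  proof (rule abs_continuous_on_left_Dini_bound)
    show "abs_continuous_on {m..b} f"
      using \<open>m \<in> S\<close> by (intro abs_continuous_on_subset[OF ac]) (auto simp: S_def)
    show "m \<le> b" using \<open>m \<in> S\<close> by (auto simp: S_def)
    show "AE t in lebesgue. m < t \<and> t \<le> b \<longrightarrow>
      (\<forall>e>0. eventually (\<lambda>s. f t - f s \<le> (0 + e) * (t - s)) (at_left t))"
      using Dini by eventually_elim (use above \<open>m \<in> S\<close> in \<open>auto simp: S_def\<close>)
  qed
  then show False using \<open>m \<in> S\<close> \<open>\<not> f b \<le> c\<close> by (simp add: S_def)
qed

text \<open>Staying above \<open>c\<close> forever would mean decrease at rate \<open>k\<close> and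
  finally a negative value. Once the level is reached, invariance of the sublevel set keeps
  \<open>f\<close> there.\<close>

lemma abs_continuous_on_eventually_sublevel:
  fixes f :: "real \<Rightarrow> real"
  assumes ac: "\<And>b. abs_continuous_on {a..b} f" and nonneg: "\<And>t. 0 \<le> f t" and "0 < k"
    and Dini: "AE t in lebesgue. a < t \<and> c < f t \<longrightarrow>
      (\<forall>e>0. eventually (\<lambda>s. f t - f s \<le> (- k + e) * (t - s)) (at_left t))"
  shows "eventually (\<lambda>t. f t \<le> c) at_top"
proof -
  have "\<exists>T\<ge>a. f T \<le> c"
  proof (rule ccontr)
    assume "\<not> ?thesis"
    then have above: "c < f t" if "a \<le> t" for t using that by (meson not_le)
    \<comment> \<open>At this time a decrease at rate \<open>k\<close> leaves at most
      \<open>f a - k * (b - a) = - k\<close>, which is negative.\<close>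
    define b where "b = a + f a / k + 1"
    have "a \<le> b" using nonneg[of a] \<open>0 < k\<close> by (simp add: b_def)
    have "f b - f a \<le> - k * (b - a)"
      using ac \<open>a \<le> b\<close>
    proof (rule abs_continuous_on_left_Dini_bound)
      show "AE t in lebesgue. a < t \<and> t \<le> b \<longrightarrow>
        (\<forall>e>0. eventually (\<lambda>s. f t - f s \<le> (- k + e) * (t - s)) (at_left t))"
        using Dini by eventually_elim (use above in auto)
    qed
    also have "\<dots> = - f a - k" using \<open>0 < k\<close> by (simp add: b_def field_simps)
    finally show False using nonneg[of b] \<open>0 < k\<close> by simp
  qed
  then obtain T where T: "a \<le> T" "f T \<le> c" by blast
  have "f b \<le> c" if "T \<le> b" for b
  proof (rule abs_continuous_on_sublevel_invariant[where f = f and a = T])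
    show "T \<le> b" "f T \<le> c" by fact+
    show "abs_continuous_on {T..b} f"
      using T by (intro abs_continuous_on_subset[OF ac[of b]]) auto
    show "AE t in lebesgue. T < t \<and> t \<le> b \<and> c < f t \<longrightarrow>
      (\<forall>e>0. eventually (\<lambda>s. f t - f s \<le> e * (t - s)) (at_left t))"
      using Dini
    proof eventually_elim
      case (elim t)
      show ?case
      proof (intro impI allI)
        fix e :: real assume t: "T < t \<and> t \<le> b \<and> c < f t" and "0 < e"
        \<comment> \<open>The tolerance \<open>k + e\<close> cancels \<open>- k\<close>, giving the
          weaker bound that invariance requires.\<close>
        then have "eventually (\<lambda>s. f t - f s \<le> (- k + (k + e)) * (t - s)) (at_left t)"
          using elim T(1) \<open>0 < k\<close> by (metis add_pos_pos order.strict_trans1)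
        then show "eventually (\<lambda>s. f t - f s \<le> e * (t - s)) (at_left t)" by simp
      qed
    qed
  qed
  then show ?thesis by (auto simp: eventually_at_top_linorder)
qed

section \<open>Block matrices and the matrix inequality\<close>

definition vjoin :: "real^'a \<Rightarrow> real^'b \<Rightarrow> real^('a + 'b)" where
  "vjoin u w = (\<chi> i. case i of Inl k \<Rightarrow> u $ k | Inr k \<Rightarrow> w $ k)"

lemma sum_UNIV_Plus:
  fixes f :: "'a::finite + 'b::finite \<Rightarrow> 'c::comm_monoid_add"
  shows "sum f UNIV = (\<Sum>i\<in>UNIV. f (Inl i)) + (\<Sum>i\<in>UNIV. f (Inr i))"
  by (simp add: UNIV_Plus_UNIV[symmetric] sum.Plus del: UNIV_Plus_UNIV)

lemma hcat_mult_vjoin: "(A <|> B) *v vjoin u w = A *v u + B *v w"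
  by (simp add: vec_eq_iff matrix_vector_mult_def hcat_def vjoin_def sum_UNIV_Plus)

lemma vcat_mult: "(A </> B) *v u = vjoin (A *v u) (B *v u)"
  by (auto simp: vec_eq_iff matrix_vector_mult_def vcat_def vjoin_def split: sum.split)

lemma transpose_hcat: "transpose (A <|> B) = (transpose A </> transpose B)"
  by (auto simp: vec_eq_iff transpose_def hcat_def vcat_def split: sum.split)

lemma transpose_vcat: "transpose (A </> B) = (transpose A <|> transpose B)"
  by (auto simp: vec_eq_iff transpose_def hcat_def vcat_def split: sum.split)

lemma inner_vjoin: "vjoin u w \<bullet> vjoin u' w' = u \<bullet> u' + w \<bullet> w'"
  by (simp add: inner_vec_def vjoin_def sum_UNIV_Plus)

lemma vjoin_add: "vjoin u w + vjoin u' w' = vjoin (u + u') (w + w')"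
  by (auto simp: vec_eq_iff vjoin_def split: sum.split)

lemma vector_matrix_mult_uminus: "u v* (- A) = - ((u :: real^'b) v* A)"
  by (simp add: vec_eq_iff vector_matrix_mult_def sum_negf)

lemma transpose_zero: "transpose (0 :: real^'a^'b) = 0"
  by (simp add: vec_eq_iff transpose_def)

lemma matrix_vector_mult_uminus: "(- A) *v u = - (A *v (u :: real^'a))"
  by (simp add: vec_eq_iff matrix_vector_mult_def sum_negf)

lemma sum_matrix_vector_mult:
  fixes F :: "'i \<Rightarrow> real^'a^'b"
  shows "(\<Sum>k\<in>K. F k) *v u = (\<Sum>k\<in>K. F k *v u)"
  by (induction K rule: infinite_finite_induct) (auto simp: matrix_vector_mult_add_rdistrib)

section \<open>Congruence and positive definite matrices\<close>

lemma inner_congruence: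
  fixes N :: "real^'a^'b" and F :: "real^'b^'b"
  shows "u \<bullet> ((transpose N ** F ** N) *v u) = (N *v u) \<bullet> (F *v (N *v u))"
  by (metis dot_lmul_matrix inner_commute matrix_vector_mul_assoc transpose_matrix_vector)

text \<open>Definiteness makes the kernel trivial, which gives a left inverse; for square matrices
  it is also a right inverse. \<open>matrix_inv\<close> chooses some two-sided inverse, so existence
  suffices.\<close>

lemma pos_def_matrix_inv:
  assumes "pos_def A"
  shows "A ** matrix_inv A = mat 1" "matrix_inv A ** A = mat 1"
proof -
  have "\<forall>u. A *v u = 0 \<longrightarrow> u = 0"
    using assms unfolding pos_def_def by (metis inner_zero_right less_irrefl)
  then have "\<exists>B. B ** A = mat 1" by (simp add: matrix_left_invertible_ker)
  then have "\<exists>B. A ** B = mat 1 \<and> B ** A = mat 1" by (metis matrix_left_right_inverse)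
  then have "A ** matrix_inv A = mat 1 \<and> matrix_inv A ** A = mat 1"
    unfolding matrix_inv_def by (rule someI_ex)
  then show "A ** matrix_inv A = mat 1" "matrix_inv A ** A = mat 1" by auto
qed

lemma symmetric_inner:
  fixes A :: "real^'a^'a"
  assumes "transpose A = A"
  shows "(A *v u) \<bullet> w = u \<bullet> (A *v w)"
  by (metis assms dot_lmul_matrix transpose_matrix_vector)

lemma pos_def_outer_add:
  assumes "0 < \<nu>"
  shows "pos_def (outer c c + \<nu> *\<^sub>R mat 1)"
proof -
  have "outer c c *v u = (c \<bullet> u) *\<^sub>R c" for u
    by (simp add: vec_eq_iff outer_def matrix_vector_mult_def inner_vec_def sum_distrib_left
        sum_distrib_right mult.commute mult.left_commute)
  then have "u \<bullet> ((outer c c + \<nu> *\<^sub>R mat 1) *v u) = (c \<bullet> u)\<^sup>2 + \<nu> * (u \<bullet> u)" for u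
    by (simp add: matrix_vector_mult_add_rdistrib scaleR_matrix_vector_assoc[symmetric]
        inner_add_right power2_eq_square inner_commute)
  moreover have "transpose (outer c c + \<nu> *\<^sub>R mat 1) = outer c c + \<nu> *\<^sub>R mat 1"
    by (auto simp: vec_eq_iff transpose_def outer_def mat_def mult.commute)
  ultimately show ?thesis
    using assms by (auto simp: pos_def_def intro!: add_nonneg_pos mult_pos_pos)
qed

text \<open>The quadratic form attains a positive minimum on the compact unit sphere, and
  homogeneity of degree two carries the bound to all vectors. It later turns decay of
  \<open>vmax\<close> into decay of the state.\<close>

lemma pos_def_lower_bound:
  assumes "pos_def (A :: real^'n^'n)"
  obtains l where "0 < l" "\<And>u. l * (norm u)\<^sup>2 \<le> u \<bullet> (A *v u)"
proof -
  have "\<exists>u\<in>sphere 0 1. \<forall>w\<in>sphere 0 1. u \<bullet> (A *v u) \<le> w \<bullet> (A *v w)"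
    by (rule continuous_attains_inf)
      (auto intro!: continuous_intros matrix_vector_mult_linear_continuous_on)
  then obtain u where u: "norm u = 1" "\<And>w. norm w = 1 \<Longrightarrow> u \<bullet> (A *v u) \<le> w \<bullet> (A *v w)"
    by auto
  show thesis
  proof
    show "0 < u \<bullet> (A *v u)" using assms u(1) unfolding pos_def_def by (metis norm_zero zero_neq_one)
    fix w :: "real^'n"
    show "u \<bullet> (A *v u) * (norm w)\<^sup>2 \<le> w \<bullet> (A *v w)"
    proof (cases "w = 0")
      case False
      then have "u \<bullet> (A *v u) \<le> (w /\<^sub>R norm w) \<bullet> (A *v (w /\<^sub>R norm w))" by (intro u(2)) simp
      also have "\<dots> = w \<bullet> (A *v w) / (norm w)\<^sup>2"
        by (simp add: matrix_vector_mult_scaleR power2_eq_square field_simps)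
      finally show ?thesis using False by (simp add: field_simps)
    qed simp
  qed
qed

text \<open>This is pointwise in the state \<open>y\<close> and the disturbance value
  \<open>w\<close>, and \<open>j\<close> may be any mode. That \<open>j\<close> is maximal enters
  only later, when the weighted sum is shown to be nonpositive.\<close>

lemma lmi_dissipation:
  fixes A :: "real^'n^'n" and B :: "real^'m^'n" and E :: "real^'q^'n"
    and X Xd W :: "real^'t^'n" and U :: "real^'t^'m"
    and \<Phi> :: "real^('n + 't)^('n + 't)"
  assumes data: "Xd = A ** X + B ** U + W"
    and noise: "psd (transpose (mat 1 </> transpose W) ** \<Phi> ** (mat 1 </> transpose W))"
    and J: "finite J" "j \<in> J" and Pj: "pos_def (P j)" and alpha: "0 \<le> \<alpha>"
    and lmi: "psd (lmi_matrix J E P L \<beta> \<pi> j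
                - \<alpha> *\<^sub>R (Gam X Xd U ** \<Phi> ** transpose (Gam X Xd U)))"
  shows "2 * ((P j *v y) \<bullet> (A *v y + B *v ((L j ** P j) *v y) + E *v w))
    \<le> \<beta> j * (w \<bullet> w - y \<bullet> (P j *v y)) + (\<Sum>k\<in>J. \<pi> k j * (y \<bullet> (P k *v y)))"
proof -
  define z where "z = P j *v y"
  define R where "R = matrix_inv (P j)"
  define Q where "Q = (\<Sum>k\<in>J - {j}. \<pi> k j *\<^sub>R P k)"
  define S where "S = (\<pi> j j - \<beta> j) *\<^sub>R R + R ** Q ** R"
  define G :: "real^('n + 't)^('q + 'n + 'n + 'm)" where "G = Gam X Xd U"
  \<comment> \<open>The last two blocks are the transposes of \<open>A\<close> and \<open>B\<close>
    applied to \<open>z\<close>. The sign of \<open>w\<close> gives the \<open>E\<close> cross term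
    the same sign as those of \<open>A\<close> and \<open>B\<close>, so that the three add up to
    minus twice the derivative term.\<close>
  define y' where "y' = vjoin (- w) (vjoin z (vjoin (z v* A) (z v* B)))"
  have Rz: "R *v z = y"
    using pos_def_matrix_inv[OF Pj] by (simp add: R_def z_def matrix_vector_mul_assoc)
  have zR: "z \<bullet> (R *v u) = y \<bullet> u" for u
    using pos_def_matrix_inv[OF Pj] symmetric_inner[of "P j" y "R *v u"] Pj
    by (simp add: R_def z_def matrix_vector_mul_assoc pos_def_def)
  \<comment> \<open>The second block is \<open>Xd - A ** X - B ** U\<close>, transposed and applied
    to \<open>z\<close>; by the data equation only \<open>W\<close> remains. The zero first block
    row of \<open>Gam\<close> removes \<open>w\<close>.\<close>
  have Gy: "transpose G *v y' = (mat 1 </> transpose W) *v z"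
    by (simp add: G_def Gam_def y'_def transpose_vcat transpose_hcat transpose_zero vcat_mult
        hcat_mult_vjoin data vjoin_add vector_matrix_mult_uminus vector_matrix_mul_assoc
        vector_matrix_mult_add_rdistrib)
  have "0 \<le> z \<bullet> ((transpose (mat 1 </> transpose W) ** \<Phi> ** (mat 1 </> transpose W)) *v z)"
    using noise by (simp add: psd_def)
  then have "0 \<le> (transpose G *v y') \<bullet> (\<Phi> *v (transpose G *v y'))"
    by (simp only: inner_congruence Gy)
  then have "0 \<le> y' \<bullet> ((G ** \<Phi> ** transpose G) *v y')"
    using inner_congruence[of y' "transpose G" \<Phi>] by simp
  then have "0 \<le> \<alpha> * (y' \<bullet> ((G ** \<Phi> ** transpose G) *v y'))"
    using alpha by simp
  also have "\<dots> \<le> y' \<bullet> (lmi_matrix J E P L \<beta> \<pi> j *v y')"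
    using lmi unfolding psd_def G_def
    by (auto simp: matrix_vector_mult_diff_rdistrib inner_diff_right scaleR_matrix_vector_assoc[symmetric])
  also have "\<dots> = \<beta> j * (w \<bullet> w) - 2 * (z \<bullet> (E *v w)) + z \<bullet> (S *v z)
      - 2 * (z \<bullet> (A *v y)) - 2 * (z \<bullet> (B *v (L j *v z)))"
  proof -
    have "lmi_matrix J E P L \<beta> \<pi> j *v y' =
      vjoin (- (\<beta> j *\<^sub>R w) + z v* E)
        (vjoin (S *v z + (- (R *v (z v* A)) - (z v* B) v* L j) - E *v w)
          (vjoin (- (R *v z)) (- (L j *v z))))"
      unfolding lmi_matrix_def Let_def R_def[symmetric] Q_def[symmetric] S_def[symmetric] y'_def
      by (simp add: vcat_mult hcat_mult_vjoin matrix_vector_mult_uminus vec.neg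
          scaleR_matrix_vector_assoc[symmetric] vector_matrix_mult_uminus)
    moreover have "w \<bullet> (z v* E) = z \<bullet> (E *v w)" "y \<bullet> (z v* A) = z \<bullet> (A *v y)"
      "z \<bullet> ((z v* B) v* L j) = z \<bullet> (B *v (L j *v z))"
      by (metis dot_lmul_matrix inner_commute)+
    ultimately show ?thesis
      by (simp add: y'_def inner_vjoin inner_add_right inner_diff_right zR Rz dot_lmul_matrix)
  qed
  \<comment> \<open>Since \<open>R *v z = y\<close>, the factors \<open>R\<close> around
    \<open>Q\<close> disappear and the form is again one in \<open>y\<close>.\<close>
  also have "z \<bullet> (S *v z) = (\<pi> j j - \<beta> j) * (y \<bullet> z) + y \<bullet> (Q *v y)"
    by (simp add: S_def matrix_vector_mult_add_rdistrib scaleR_matrix_vector_assoc[symmetric]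
        matrix_vector_mul_assoc[symmetric] inner_add_right zR Rz inner_commute[of z y])
  also have "y \<bullet> (Q *v y) = (\<Sum>k\<in>J - {j}. \<pi> k j * (y \<bullet> (P k *v y)))"
    by (simp add: Q_def sum_matrix_vector_mult inner_sum_right scaleR_matrix_vector_assoc[symmetric])
  \<comment> \<open>The term with \<open>\<pi> j j\<close> is the summand \<open>k = j\<close> that
    was left out of \<open>Q\<close>.\<close>
  finally show ?thesis
    using J by (simp add: z_def sum.remove[of J j] matrix_vector_mul_assoc inner_add_right algebra_simps)
qed

section \<open>The max-type Lyapunov function\<close>

lemma vmax_ge:
  assumes "finite J" "j \<in> J"
  shows "y \<bullet> (P j *v y) \<le> vmax J P y"
  using assms by (simp add: vmax_def)

text \<open>The maximum over a finite nonempty family is attained, so the set of maximizers is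
  finite and nonempty and \<open>Min\<close> selects one of its members.\<close>

lemma switch_mem_vmax_eq:
  assumes "finite J" "J \<noteq> {}"
  shows "switch J P y \<in> J" "vmax J P y = y \<bullet> (P (switch J P y) *v y)"
proof -
  let ?v = "\<lambda>j. y \<bullet> (P j *v y)"
  let ?S = "{j. is_arg_max ?v (\<lambda>j. j \<in> J) j}"
  have "vmax J P y \<in> ?v ` J"
    unfolding vmax_def using assms by (intro Max_in) auto
  then obtain j where "j \<in> J" "vmax J P y = ?v j" by auto
  then have "j \<in> ?S"
    using vmax_ge[OF assms(1), of _ y P] by (auto simp: is_arg_max_def not_less)
  moreover have "finite ?S" using assms(1) by (auto simp: is_arg_max_def)
  ultimately have S: "switch J P y \<in> ?S"
    unfolding switch_def by (intro Min_in) auto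
  then show "switch J P y \<in> J" by (simp add: is_arg_max_def)
  show "vmax J P y = ?v (switch J P y)"
    using S \<open>j \<in> J\<close> \<open>vmax J P y = ?v j\<close> vmax_ge[OF assms(1), of "switch J P y" y P]
    by (auto simp: is_arg_max_def not_less intro!: antisym)
qed

text \<open>The index active at \<open>u\<close> gives the exact value there and a lower bound at
  \<open>w\<close>, so the difference is at most \<open>(u - w) \<bullet> (P j *v (u + w))\<close>.
  Exchanging \<open>u\<close> and \<open>w\<close> gives the absolute value.\<close>

lemma vmax_Lipschitz_on_bounded:
  fixes P :: "nat \<Rightarrow> real^'n^'n"
  assumes J: "finite J" "J \<noteq> {}" and sym: "\<And>j. j \<in> J \<Longrightarrow> transpose (P j) = P j"
    and "bounded S"
  shows "\<exists>C. \<forall>u\<in>S. \<forall>w\<in>S. norm (vmax J P u - vmax J P w) \<le> C * norm (u - w)"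
proof -
  obtain r where r: "\<And>u. u \<in> S \<Longrightarrow> norm u \<le> r"
    using \<open>bounded S\<close> by (auto simp: bounded_iff)
  \<comment> \<open>The sum dominates the operator norm for whichever index is active, and
    \<open>2 * r\<close> bounds \<open>norm (u + w)\<close>.\<close>
  define C where "C = (\<Sum>j\<in>J. onorm ((*v) (P j))) * (2 * r)"
  have le: "vmax J P u - vmax J P w \<le> C * norm (u - w)" if "u \<in> S" "w \<in> S" for u w
  proof -
    define j where "j = switch J P u"
    have j: "j \<in> J" "vmax J P u = u \<bullet> (P j *v u)"
      using switch_mem_vmax_eq[OF J] by (auto simp: j_def)
    have "0 \<le> r" using r[OF \<open>u \<in> S\<close>] norm_ge_zero order_trans by blast
    have on: "0 \<le> onorm ((*v) (P i))" for i
      by (intro onorm_pos_le matrix_vector_mul_bounded_linear)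
    have "vmax J P u - vmax J P w \<le> u \<bullet> (P j *v u) - w \<bullet> (P j *v w)"
      using j vmax_ge[OF J(1), of j w P] by simp
    also have "\<dots> = (u - w) \<bullet> (P j *v (u + w))"
      using symmetric_inner[OF sym[OF j(1)], of u w]
      by (simp add: algebra_simps inner_commute)
    also have "\<dots> \<le> norm (u - w) * norm (P j *v (u + w))" by (rule norm_cauchy_schwarz)
    also have "\<dots> \<le> norm (u - w) * (onorm ((*v) (P j)) * norm (u + w))"
      by (intro mult_left_mono onorm matrix_vector_mul_bounded_linear) auto
    also have "\<dots> \<le> norm (u - w) * ((\<Sum>j\<in>J. onorm ((*v) (P j))) * (2 * r))"
      using j(1) J(1) on r[OF that(1)] r[OF that(2)] norm_triangle_ineq[of u w] \<open>0 \<le> r\<close>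
      by (intro mult_left_mono mult_mono member_le_sum sum_nonneg) auto
    finally show ?thesis by (simp add: C_def mult.commute)
  qed
  have "norm (vmax J P u - vmax J P w) \<le> C * norm (u - w)" if "u \<in> S" "w \<in> S" for u w
    using le[OF that] le[OF that(2,1)] by (simp add: abs_le_iff norm_minus_commute)
  then show ?thesis by blast
qed

lemma abs_continuous_on_vmax:
  fixes x :: "real \<Rightarrow> real^'n"
  assumes "finite J" "J \<noteq> {}" "\<And>j. j \<in> J \<Longrightarrow> transpose (P j) = P j"
    and x: "abs_continuous_on {a..b} x"
  shows "abs_continuous_on {a..b} (\<lambda>t. vmax J P (x t))"
proof -
  have "bounded (x ` {a..b})"
    using x by (intro compact_imp_bounded compact_continuous_image
        abs_continuous_on_imp_continuous_on) auto
  then obtain C where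
    "\<forall>u\<in>x ` {a..b}. \<forall>w\<in>x ` {a..b}. norm (vmax J P u - vmax J P w) \<le> C * norm (u - w)"
    using vmax_Lipschitz_on_bounded[of J P, OF assms(1-3)] by blast
  then show ?thesis
    by (intro abs_continuous_on_Lipschitz_compose[OF x, where C = C]) simp
qed

text \<open>For the index active at \<open>t\<close>, the form \<open>?g\<close> equals
  \<open>vmax\<close> at \<open>t\<close> and lies below it elsewhere. To the left of
  \<open>t\<close> this bounds growth from above; to the right it would only bound it from
  below.\<close>

lemma vmax_left_Dini:
  fixes x :: "real \<Rightarrow> real^'n"
  assumes J: "finite J" "J \<noteq> {}" and sym: "\<And>j. j \<in> J \<Longrightarrow> transpose (P j) = P j"
    and x: "(x has_vector_derivative d) (at t)"
    and k: "2 * ((P (switch J P (x t)) *v x t) \<bullet> d) \<le> k" and "0 < e"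
  shows "eventually (\<lambda>s. vmax J P (x t) - vmax J P (x s) \<le> (k + e) * (t - s)) (at_left t)"
proof -
  define j where "j = switch J P (x t)"
  have j: "j \<in> J" "vmax J P (x t) = x t \<bullet> (P j *v x t)"
    using switch_mem_vmax_eq[OF J] by (auto simp: j_def)
  let ?g = "\<lambda>s. x s \<bullet> (P j *v x s)"
  have "(?g has_real_derivative 2 * ((P j *v x t) \<bullet> d)) (at t)"
  proof -
    have "((\<lambda>s. P j *v x s) has_vector_derivative P j *v d) (at t)"
      by (rule bounded_linear.has_vector_derivative[OF matrix_vector_mul_bounded_linear x])
    then have "(?g has_vector_derivative (x t \<bullet> (P j *v d) + d \<bullet> (P j *v x t))) (at t)"
      by (rule bounded_bilinear.has_vector_derivative[OF bounded_bilinear_inner x])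
    then show ?thesis
      using symmetric_inner[OF sym[OF j(1)], of "x t" d]
      by (simp add: has_real_derivative_iff_has_vector_derivative inner_commute)
  qed
  then have "((\<lambda>s. (?g s - ?g t) / (s - t)) \<longlongrightarrow> 2 * ((P j *v x t) \<bullet> d)) (at_left t)"
    unfolding has_field_derivative_iff by (rule filterlim_mono) (auto simp: at_le)
  then have "eventually (\<lambda>s. (?g s - ?g t) / (s - t) < k + e) (at_left t)"
    using k \<open>0 < e\<close> by (intro order_tendstoD(2)) (auto simp: j_def)
  moreover have "eventually (\<lambda>s. s < t) (at_left t)"
    by (simp add: eventually_at_filter)
  ultimately show ?thesis
  proof eventually_elim
    case (elim s)
    have "?g t - ?g s \<le> (k + e) * (t - s)"
      using elim by (simp add: field_simps)
    moreover have "?g s \<le> vmax J P (x s)"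
      by (intro vmax_ge J j)
    ultimately show ?case using j(2) by simp
  qed
qed

text \<open>Off-diagonal weights are positive, so raising each \<open>v k\<close> to
  \<open>v j\<close> can only increase the sum; the diagonal term stays the same whatever its sign.
  The columns sum to zero.\<close>

lemma Mplus_weighted_sum_nonpos:
  assumes "Mplus J \<pi>" "finite J" "j \<in> J" and max: "\<And>k. k \<in> J \<Longrightarrow> v k \<le> v j"
  shows "(\<Sum>k\<in>J. \<pi> k j * v k) \<le> 0"
proof -
  have "(\<Sum>k\<in>J. \<pi> k j * v k) \<le> (\<Sum>k\<in>J. \<pi> k j * v j)"
  proof (rule sum_mono)
    fix k assume "k \<in> J"
    then show "\<pi> k j * v k \<le> \<pi> k j * v j"
      using assms by (cases "k = j") (auto simp: Mplus_def intro!: mult_left_mono less_imp_le)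
  qed
  also have "\<dots> = 0"
    using assms by (simp add: Mplus_def sum_distrib_right[symmetric])
  finally show ?thesis .
qed

section \<open>Invariance and convergence for the closed loop\<close>

theorem theorem5:
  fixes A :: "real^'n^'n" and B :: "real^'m^'n" and E :: "real^'q^'n"
    and X Xd W :: "real^'t^'n" and U :: "real^'t^'m"
    and \<Phi> :: "real^('n + 't)^('n + 't)"
    and \<Phi>11 :: "real^'n^'n" and \<Phi>12 :: "real^'t^'n" and \<Phi>22 :: "real^'t^'t"
    and M :: nat and J J0 :: "nat set" and c :: "nat \<Rightarrow> real^'n" and \<nu> :: real
    and P :: "nat \<Rightarrow> real^'n^'n" and L :: "nat \<Rightarrow> real^'n^'m"
    and \<alpha> \<beta> :: "nat \<Rightarrow> real" and \<pi> :: "nat \<Rightarrow> nat \<Rightarrow> real"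
    and \<psi> :: "real \<Rightarrow> real^'q" and x :: "real \<Rightarrow> real^'n"
  assumes J: "J = {1..M}" and J0: "J0 = J \<union> {0}"
    and data: "Xd = A ** X + B ** U + W"
    and Phi: "\<Phi> = (\<Phi>11 <|> \<Phi>12 </> transpose \<Phi>12 <|> \<Phi>22)"
    and Phi_sym: "transpose \<Phi> = \<Phi>"
    and Phi22: "pos_def (- \<Phi>22)"
    and noise: "psd (transpose (mat 1 </> transpose W) ** \<Phi> ** (mat 1 </> transpose W))"
    and nu: "0 < \<nu>"
    and P0: "pos_def (P 0)"
    and PJ: "\<forall>j\<in>J. P j = outer (c j) (c j) + \<nu> *\<^sub>R mat 1"
    and beta: "\<forall>j\<in>J0. 0 \<le> \<beta> j" and alpha: "\<forall>j\<in>J0. 0 \<le> \<alpha> j"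
    and Pi: "Mplus J0 \<pi>"
    and lmi: "\<forall>j\<in>J0. psd (lmi_matrix J0 E P L \<beta> \<pi> j
                - \<alpha> j *\<^sub>R (Gam X Xd U ** \<Phi> ** transpose (Gam X Xd U)))"
    and psi: "\<forall>t\<ge>0. \<psi> t \<bullet> \<psi> t \<le> 1"
    and sol: "caratheodory_solution
                (\<lambda>t y. A *v y + B *v controller J0 P L y + E *v \<psi> t) x"
    and init: "x 0 \<in> X0 J0 P"
  shows "(\<forall>t\<ge>0. x t \<in> X0 J0 P) \<and>
         ((\<forall>j\<in>J0. 0 < \<beta> j) \<and> (\<psi> \<longlongrightarrow> 0) at_top \<longrightarrow> (x \<longlongrightarrow> 0) at_top)"
proof -
  have fin: "finite J0" and ne: "J0 \<noteq> {}" and "0 \<in> J0"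
    using J J0 by auto
  have pd: "pos_def (P j)" if "j \<in> J0" for j
    using that P0 PJ J0 pos_def_outer_add[OF nu] by auto
  then have sym: "transpose (P j) = P j" if "j \<in> J0" for j
    using that by (simp add: pos_def_def)
  obtain l where l: "0 < l" "\<And>u. l * (norm u)\<^sup>2 \<le> u \<bullet> (P 0 *v u)"
    using pos_def_lower_bound[OF P0] by blast
  define f where "f t = vmax J0 P (x t)" for t
  have lower: "l * (norm (x t))\<^sup>2 \<le> f t" for t
    using l(2)[of "x t"] vmax_ge[OF fin \<open>0 \<in> J0\<close>, of "x t" P] by (simp add: f_def)
  have nonneg: "0 \<le> f t" for t
    using lower[of t] l(1) by (meson mult_nonneg_nonneg less_imp_le order_trans zero_le_power2)
  have ac: "abs_continuous_on {a..b} f" if "0 \<le> a" for a b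
  proof -
    \<comment> \<open>The maximum covers negative \<open>b\<close>, for which \<open>{a..b}\<close>
      is empty.\<close>
    have "abs_continuous_on {0..max 0 b} x"
      using sol by (simp add: caratheodory_solution_def)
    then have "abs_continuous_on {a..b} x"
      by (rule abs_continuous_on_subset) (use that in auto)
    then show ?thesis
      unfolding f_def by (intro abs_continuous_on_vmax fin ne sym)
  qed
  \<comment> \<open>The active mode \<open>j\<close> varies with \<open>t\<close>; allowing every
    \<open>k\<close> above its rate lets later steps insert one constant for all times.\<close>
  have diss: "AE t in lebesgue. 0 < t \<longrightarrow> (\<exists>j\<in>J0. \<forall>k\<ge>\<beta> j * (\<psi> t \<bullet> \<psi> t - f t). \<forall>e>0.
      eventually (\<lambda>s. f t - f s \<le> (k + e) * (t - s)) (at_left t))"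
  proof -
    have "AE t in lebesgue. 0 \<le> t \<longrightarrow> (x has_vector_derivative
        (A *v x t + B *v controller J0 P L (x t) + E *v \<psi> t)) (at t within {0..})"
      using sol by (simp add: caratheodory_solution_def)
    then show ?thesis
    proof eventually_elim
      case (elim t)
      show ?case
      proof (intro impI bexI allI)
        let ?j = "switch J0 P (x t)" and ?d = "A *v x t + B *v controller J0 P L (x t) + E *v \<psi> t"
        assume "0 < t"
        show j: "?j \<in> J0" by (rule switch_mem_vmax_eq[OF fin ne])
        have ft: "f t = x t \<bullet> (P ?j *v x t)"
          unfolding f_def by (rule switch_mem_vmax_eq[OF fin ne])
        have "at t within {0..} = at t"
          using \<open>0 < t\<close> by (intro at_within_interior) auto
        then have deriv: "(x has_vector_derivative ?d) (at t)"
          using elim \<open>0 < t\<close> by simp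
        have "2 * ((P ?j *v x t) \<bullet> ?d) \<le> \<beta> ?j * (\<psi> t \<bullet> \<psi> t - x t \<bullet> (P ?j *v x t))
            + (\<Sum>k\<in>J0. \<pi> k ?j * (x t \<bullet> (P k *v x t)))"
          unfolding controller_def
          using lmi_dissipation[OF data noise fin j pd[OF j] alpha[rule_format, OF j] lmi[rule_format, OF j]] .
        also have "(\<Sum>k\<in>J0. \<pi> k ?j * (x t \<bullet> (P k *v x t))) \<le> 0"
          using Pi fin j
        proof (rule Mplus_weighted_sum_nonpos)
          fix k assume "k \<in> J0"
          then show "x t \<bullet> (P k *v x t) \<le> x t \<bullet> (P ?j *v x t)"
            using vmax_ge[OF fin, of k "x t" P] ft by (simp add: f_def)
        qed
        finally have rate: "2 * ((P ?j *v x t) \<bullet> ?d) \<le> \<beta> ?j * (\<psi> t \<bullet> \<psi> t - f t)"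
          by (simp add: ft)
        fix k e :: real assume "\<beta> ?j * (\<psi> t \<bullet> \<psi> t - f t) \<le> k" "0 < e"
        then show "eventually (\<lambda>s. f t - f s \<le> (k + e) * (t - s)) (at_left t)"
          using rate unfolding f_def by (intro vmax_left_Dini[OF fin ne sym deriv]) auto
      qed
    qed
  qed
  have "f t \<le> 1" if "0 \<le> t" for t
    using ac[of 0 t] that
  proof (rule abs_continuous_on_sublevel_invariant)
    show "f 0 \<le> 1" using init by (simp add: f_def X0_def)
    show "AE s in lebesgue. 0 < s \<and> s \<le> t \<and> 1 < f s \<longrightarrow>
      (\<forall>e>0. eventually (\<lambda>r. f s - f r \<le> e * (s - r)) (at_left s))"
      using diss
    proof eventually_elim
      case (elim s)
      show ?case
      proof
        assume s: "0 < s \<and> s \<le> t \<and> 1 < f s"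
        then obtain j where j: "j \<in> J0" "\<And>k e. \<beta> j * (\<psi> s \<bullet> \<psi> s - f s) \<le> k \<Longrightarrow> 0 < e \<Longrightarrow>
            eventually (\<lambda>r. f s - f r \<le> (k + e) * (s - r)) (at_left s)"
          using elim by blast
        have "\<psi> s \<bullet> \<psi> s \<le> 1" using psi s by simp
        \<comment> \<open>Above level 1 the state term outweighs the disturbance, whose squared norm
          is at most 1.\<close>
        then have "\<beta> j * (\<psi> s \<bullet> \<psi> s - f s) \<le> 0"
          using beta j(1) s by (intro mult_nonneg_nonpos) auto
        then show "\<forall>e>0. eventually (\<lambda>r. f s - f r \<le> e * (s - r)) (at_left s)"
          using j(2)[of 0] by simp
      qed
    qed
  qed simp
  moreover have "(x \<longlongrightarrow> 0) at_top" if pos: "\<forall>j\<in>J0. 0 < \<beta> j" and lim: "(\<psi> \<longlongrightarrow> 0) at_top"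
  proof -
    have small: "eventually (\<lambda>t. f t \<le> c) at_top" if "0 < c" for c
    proof -
      \<comment> \<open>Finitely many modes have a common positive rate \<open>b\<close>. Past
        \<open>T0\<close> and above level \<open>c\<close>, the gap
        \<open>f t - \<psi> t \<bullet> \<psi> t\<close> is at least \<open>c / 2\<close>, so
        \<open>f\<close> falls at rate \<open>b * (c / 2)\<close>.\<close>
      define b where "b = Min (\<beta> ` J0)"
      have "0 < b" unfolding b_def using pos fin ne by simp
      have "((\<lambda>t. \<psi> t \<bullet> \<psi> t) \<longlongrightarrow> 0 \<bullet> (0 :: real^'q)) at_top" by (intro tendsto_inner lim)
      then have "eventually (\<lambda>t. \<psi> t \<bullet> \<psi> t < c / 2) at_top"
        using \<open>0 < c\<close> by (intro order_tendstoD(2)) auto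
      then obtain T0 where T0: "\<And>t. T0 \<le> t \<Longrightarrow> \<psi> t \<bullet> \<psi> t < c / 2"
        by (auto simp: eventually_at_top_linorder)
      show ?thesis
      proof (rule abs_continuous_on_eventually_sublevel[where a = "max 0 T0" and k = "b * (c / 2)"])
        show "AE t in lebesgue. max 0 T0 < t \<and> c < f t \<longrightarrow>
          (\<forall>e>0. eventually (\<lambda>s. f t - f s \<le> (- (b * (c / 2)) + e) * (t - s)) (at_left t))"
          using diss
        proof eventually_elim
          case (elim t)
          show ?case
          proof
            assume t: "max 0 T0 < t \<and> c < f t"
            then obtain j where j: "j \<in> J0" "\<And>k e. \<beta> j * (\<psi> t \<bullet> \<psi> t - f t) \<le> k \<Longrightarrow> 0 < e \<Longrightarrow>
                eventually (\<lambda>s. f t - f s \<le> (k + e) * (t - s)) (at_left t)"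
              using elim by auto
            have "b \<le> \<beta> j" unfolding b_def using fin j(1) by simp
            moreover have "c / 2 \<le> f t - \<psi> t \<bullet> \<psi> t" using T0[of t] t by simp
            ultimately have "b * (c / 2) \<le> \<beta> j * (f t - \<psi> t \<bullet> \<psi> t)"
              using \<open>0 < b\<close> \<open>0 < c\<close> by (intro mult_mono) auto
            then have "\<beta> j * (\<psi> t \<bullet> \<psi> t - f t) \<le> - (b * (c / 2))" by (simp add: algebra_simps)
            then show "\<forall>e>0. eventually (\<lambda>s. f t - f s \<le> (- (b * (c / 2)) + e) * (t - s)) (at_left t)"
              using j(2) by blast
          qed
        qed
      qed (use ac nonneg \<open>0 < b\<close> \<open>0 < c\<close> in auto)
    qed
    show ?thesis
    proof (rule tendstoI)
      fix r :: real assume "0 < r"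
      \<comment> \<open>By \<open>lower\<close>, this level forces the norm to be at most
        \<open>r / 2\<close>, which is strictly below \<open>r\<close>.\<close>
      then have "eventually (\<lambda>t. f t \<le> l * (r / 2)\<^sup>2) at_top"
        using l(1) by (intro small) auto
      then show "eventually (\<lambda>t. dist (x t) 0 < r) at_top"
      proof eventually_elim
        case (elim t)
        then have "(norm (x t))\<^sup>2 \<le> (r / 2)\<^sup>2"
          using lower[of t] l(1) by (meson mult_le_cancel_left_pos order_trans)
        then have "norm (x t) \<le> r / 2"
          by (rule power2_le_imp_le) (use \<open>0 < r\<close> in simp)
        then show ?case using \<open>0 < r\<close> by simp
      qed
    qed
  qed
  ultimately show ?thesis by (auto simp: X0_def f_def)
qed

end
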